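(* Let $R$ be an associative ring (not necessarily unital), let $a_1,a_2,b,c\in R$, and suppose that for some positive integer $n$ the element $(a_1a_2)^{n+1}$ is annihilator $(b,c)$-invertible with annihilator $(b,c)$-inverse $x$. Then $(a_2a_1)^{n}$ is annihilator $(a_2b,ca_1)$-invertible, and its annihilator $(a_2b,ca_1)$-inverse is $a_2xa_1$.
   Context: For $u\in R$ write ${}^{\circ}u=\{r\in R: ru=0\}$ and $u^{\circ}=\{r\in R: ur=0\}$. For $a,b,c\in R$, an element $x\in R$ is an annihilator $(b,c)$-inverse of $a$ if $xax=x$, $xab=b$, $cax=c$, ${}^{\circ}b\subseteq{}^{\circ}x$, and $c^{\circ}\subseteq x^{\circ}$; such $x$ is unique when it exists, and $a$ is then called annihilator $(b,c)$-invertible. *)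

theory Defs
  imports Main
begin

text \<open>
  The type class \<^class>\<open>ring\<close> is that of associative rings that need not have a unit.  Powers
  \<open>a\<^sup>n\<close> therefore exist only for \<open>n \<ge> 1\<close>, and the library power, which requires a unit, is not
  available; \<open>ppow a 0\<close> is deliberately left unspecified.
\<close>

fun ppow :: "'a::semigroup_mult \<Rightarrow> nat \<Rightarrow> 'a" where
  "ppow a (Suc 0) = a"
| "ppow a (Suc (Suc n)) = ppow a (Suc n) * a"

definition left_annihilator :: "'a::ring \<Rightarrow> 'a set" where
  "left_annihilator u = {r. r * u = 0}"

definition right_annihilator :: "'a::ring \<Rightarrow> 'a set" where
  "right_annihilator u = {r. u * r = 0}"

definition is_annihilator_inverse :: "'a::ring \<Rightarrow> 'a \<Rightarrow> 'a \<Rightarrow> 'a \<Rightarrow> bool" where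
  "is_annihilator_inverse b c a x \<longleftrightarrow>
     x * a * x = x \<and> x * a * b = b \<and> c * a * x = c \<and>
     left_annihilator b \<subseteq> left_annihilator x \<and>
     right_annihilator c \<subseteq> right_annihilator x"

definition annihilator_invertible :: "'a::ring \<Rightarrow> 'a \<Rightarrow> 'a \<Rightarrow> bool" where
  "annihilator_invertible b c a \<longleftrightarrow> (\<exists>x. is_annihilator_inverse b c a x)"

text \<open>Uniqueness justifies speaking of \<^emph>\<open>the\<close> annihilator \<open>(b,c)\<close>-inverse.\<close>

lemma is_annihilator_inverse_unique:
  fixes a b c x y :: "'a::ring"
  assumes x: "is_annihilator_inverse b c a x" and y: "is_annihilator_inverse b c a y"
  shows "x = y"
proof -
  have "x * a - y * a \<in> left_annihilator b"
    using x y by (simp add: is_annihilator_inverse_def left_annihilator_def left_diff_distrib)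
  then have "x * a - y * a \<in> left_annihilator y"
    using y by (auto simp: is_annihilator_inverse_def)
  then have 1: "x * a * y = y"
    using y by (simp add: is_annihilator_inverse_def left_annihilator_def left_diff_distrib)
  have "a * x - a * y \<in> right_annihilator c"
    using x y
    by (simp add: is_annihilator_inverse_def right_annihilator_def right_diff_distrib mult.assoc)
  then have "a * x - a * y \<in> right_annihilator x"
    using x by (auto simp: is_annihilator_inverse_def)
  then have "x * a * y = x"
    using x
    by (simp add: is_annihilator_inverse_def right_annihilator_def right_diff_distrib mult.assoc)
  with 1 show ?thesis by simp
qed

end

theory Submission
  imports Defs
begin

text \<open>
  Regrouping the alternating word \<open>a1 a2 a1 a2 \<dots> a1 a2\<close> gives
  \<open>(a1 a2)\<^sup>n\<^sup>+\<^sup>1 = a1 (a2 a1)\<^sup>n a2\<close> (lemma \<open>mult_ppow_mult\<close>).  The powers matter only through this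
  factorization: whenever \<open>x\<close> inverts a product \<open>u d v\<close>, the outer factors can be moved from the
  inverted element to its inverse, so that \<open>v x u\<close> inverts the middle factor \<open>d\<close>
  (lemma \<open>is_annihilator_inverse_middle_factor\<close>).
\<close>

lemma mult_ppow_mult:
  fixes u v :: "'a::semigroup_mult"
  assumes "n \<ge> 1"
  shows "u * ppow (v * u) n * v = ppow (u * v) (Suc n)"
  using assms
proof (induction n rule: dec_induct)
  case base
  show ?case by (simp add: mult.assoc)
next
  case (step n)
  then obtain m where n: "n = Suc m" by (cases n) auto
  have "u * ppow (v * u) (Suc n) * v = (u * ppow (v * u) n * v) * (u * v)"
    by (simp add: n mult.assoc)
  also have "\<dots> = ppow (u * v) (Suc (Suc n))"
    using step.IH by simp
  finally show ?case .
qed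

text \<open>
  In each of the three equations for \<open>v * x * u\<close>, the factors \<open>u\<close> and \<open>v\<close> adjacent to \<open>d\<close> restore
  the product \<open>u * d * v\<close>, and what remains is the corresponding equation for \<open>x\<close>, multiplied by
  \<open>v\<close> on the left, by \<open>u\<close> on the right, or by both.  For the annihilators, \<open>r * (v * b) = 0\<close> says
  that \<open>r * v\<close> annihilates \<open>b\<close> from the left, hence also \<open>x\<close>; symmetrically on the right.
\<close>

lemma is_annihilator_inverse_middle_factor:
  fixes u d v b c x :: "'a::ring"
  assumes "is_annihilator_inverse b c (u * d * v) x"
  shows "is_annihilator_inverse (v * b) (c * u) d (v * x * u)"
proof -
  from assms have xax: "x * (u * d * v) * x = x" and xab: "x * (u * d * v) * b = b"
    and cax: "c * (u * d * v) * x = c"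
    and l: "\<And>r. r * b = 0 \<Longrightarrow> r * x = 0" and r: "\<And>r. c * r = 0 \<Longrightarrow> x * r = 0"
    by (auto simp: is_annihilator_inverse_def left_annihilator_def right_annihilator_def)
  have "v * x * u * d * (v * x * u) = v * (x * (u * d * v) * x) * u"
    by (simp only: mult.assoc)
  then have 1: "v * x * u * d * (v * x * u) = v * x * u"
    by (simp only: xax)
  have "v * x * u * d * (v * b) = v * (x * (u * d * v) * b)"
    by (simp only: mult.assoc)
  then have 2: "v * x * u * d * (v * b) = v * b"
    by (simp only: xab)
  have "c * u * d * (v * x * u) = (c * (u * d * v) * x) * u"
    by (simp only: mult.assoc)
  then have 3: "c * u * d * (v * x * u) = c * u"
    by (simp only: cax)
  have 4: "s * (v * x * u) = 0" if "s * (v * b) = 0" for s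
  proof -
    from that have "s * v * x = 0" by (intro l) (simp add: mult.assoc)
    then have "s * v * x * u = 0" by simp
    then show ?thesis by (simp only: mult.assoc)
  qed
  have 5: "v * x * u * s = 0" if "c * u * s = 0" for s
  proof -
    from that have "x * (u * s) = 0" by (intro r) (simp add: mult.assoc)
    then show ?thesis by (simp add: mult.assoc)
  qed
  from 1 2 3 4 5 show ?thesis
    by (auto simp: is_annihilator_inverse_def left_annihilator_def right_annihilator_def)
qed

theorem theorem5p1:
  fixes a1 a2 b c x :: "'a::ring" and n :: nat
  assumes "n \<ge> 1"
    and "is_annihilator_inverse b c (ppow (a1 * a2) (n + 1)) x"
  shows "annihilator_invertible (a2 * b) (c * a1) (ppow (a2 * a1) n) \<and>
    is_annihilator_inverse (a2 * b) (c * a1) (ppow (a2 * a1) n) (a2 * x * a1)"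
proof -
  have "is_annihilator_inverse b c (a1 * ppow (a2 * a1) n * a2) x"
    using assms by (simp add: mult_ppow_mult)
  then have "is_annihilator_inverse (a2 * b) (c * a1) (ppow (a2 * a1) n) (a2 * x * a1)"
    by (rule is_annihilator_inverse_middle_factor)
  then show ?thesis
    unfolding annihilator_invertible_def by blast
qed

end
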